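(* Let $f\in\mathbb{C}\{x,y\}$ with $f(0)=0$ and let $g=x^{m_1}y^{m_2}\,U$ with $U(0)\neq0$. Write $\ell_x=\operatorname{ord}_xf(x,0)$ and $\ell_y=\operatorname{ord}_yf(0,y)$ for the intercepts of the Newton diagram of $f$ with the coordinate axes. Then $$I_0(f,g)=m_1\,\ell_y+m_2\,\ell_x .$$ No nondegeneracy hypothesis is required.
   Context: $\mathbb{C}\{x,y\}$ is the ring of convergent power series in two variables, $U\in\mathbb{C}\{x,y\}$, and $m_1,m_2$ are nonnegative integers. $I_0(f,g)=\dim_{\mathbb{C}}\mathbb{C}\{x,y\}/(f,g)$ is the local intersection number at the origin. $\operatorname{ord}$ is the order of vanishing at $0$ of a one-variable power series, with the convention $\ell=\infty$ when the corresponding restriction ($f(x,0)$ for $\ell_x$, $f(0,y)$ for $\ell_y$) vanishes identically. The Newton diagram of $f$ is the union of the compact faces of the convex hull of $\bigcup_{\alpha\in\operatorname{supp}f}(\alpha+\mathbb{R}^2_{\ge0})$, where $\operatorname{supp}f$ is the set of exponents of the monomials appearing in $f$. *)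

theory Defs
  imports
    "HOL-Algebra.Embedded_Algebras"
    "HOL-Algebra.QuotRing"
    "HOL-Analysis.Infinite_Sum"
    "HOL-Computational_Algebra.Formal_Power_Series"
    "HOL-Library.Extended_Nat"
begin

text \<open>
  A formal power series in \<open>x\<close>, \<open>y\<close> is an element of \<open>\<complex>[[x]][[y]]\<close>, i.e. of type
  \<^typ>\<open>complex fps fps\<close>: the outer index is the exponent of \<open>y\<close>, the inner one that of \<open>x\<close>.
\<close>

definition coeff2 :: "complex fps fps \<Rightarrow> nat \<Rightarrow> nat \<Rightarrow> complex" where
  "coeff2 F i j = fps_nth (fps_nth F j) i"

definition const2 :: "complex \<Rightarrow> complex fps fps" where
  "const2 c = fps_const (fps_const c)"

definition var_x :: "complex fps fps" where
  "var_x = fps_const fps_X"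

definition var_y :: "complex fps fps" where
  "var_y = fps_X"

definition value0 :: "complex fps fps \<Rightarrow> complex" where
  "value0 F = coeff2 F 0 0"

text \<open>
  Convergence in a polydisc around the origin. Summability over the unordered index set
  \<open>\<nat> \<times> \<nat>\<close> is the same as absolute convergence here.
\<close>

definition convergent2 :: "complex fps fps \<Rightarrow> bool" where
  "convergent2 F \<longleftrightarrow>
     (\<exists>r>0. \<forall>x y. norm x < r \<longrightarrow> norm y < r \<longrightarrow>
        (\<lambda>(i, j). coeff2 F i j * x ^ i * y ^ j) summable_on UNIV)"

definition conv_series :: "complex fps fps ring" ("\<complex>xy") where
  "\<complex>xy = \<lparr>carrier = {F. convergent2 F}, monoid.mult = (*), one = 1,
           ring.zero = 0, add = (+)\<rparr>"

definition restrict_x_axis :: "complex fps fps \<Rightarrow> complex fps" where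
  "restrict_x_axis F = Abs_fps (\<lambda>i. coeff2 F i 0)"

definition restrict_y_axis :: "complex fps fps \<Rightarrow> complex fps" where
  "restrict_y_axis F = Abs_fps (\<lambda>j. coeff2 F 0 j)"

text \<open>
  The order is infinite for the zero series. In \<^typ>\<open>enat\<close> one has \<open>0 * \<infinity> = 0\<close>, so a factor
  \<open>x ^ 0\<close> or \<open>y ^ 0\<close> contributes nothing to an intersection number.
\<close>

definition ord0 :: "complex fps \<Rightarrow> enat" where
  "ord0 p = (if p = 0 then \<infinity> else enat (subdegree p))"

text \<open>
  \<open>ell_x f\<close> and \<open>ell_y f\<close> are the orders of \<open>f(x,0)\<close> and \<open>f(0,y)\<close>, i.e. the coordinates of the
  points in which the Newton diagram of \<open>f\<close> meets the axes.
\<close>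

definition ell_x :: "complex fps fps \<Rightarrow> enat" where
  "ell_x F = ord0 (restrict_x_axis F)"

definition ell_y :: "complex fps fps \<Rightarrow> enat" where
  "ell_y F = ord0 (restrict_y_axis F)"

definition local_algebra ::
    "complex fps fps \<Rightarrow> complex fps fps \<Rightarrow> complex fps fps set ring" where
  "local_algebra f g = \<complex>xy Quot (genideal \<complex>xy {f, g})"

text \<open>
  The image of \<open>\<complex>\<close> in the local algebra. If \<open>f\<close> and \<open>g\<close> generate the unit ideal, both the local
  algebra and this image are the zero ring, and the relation \<^const>\<open>ring.dimension\<close> below still
  assigns it the dimension \<open>0\<close>.
\<close>

definition scalars ::
    "complex fps fps \<Rightarrow> complex fps fps \<Rightarrow> complex fps fps set set" where
  "scalars f g = (\<lambda>c. genideal \<complex>xy {f, g} +>\<^bsub>\<complex>xy\<^esub> const2 c) ` UNIV"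

definition has_dim ::
    "complex fps fps \<Rightarrow> complex fps fps \<Rightarrow> nat \<Rightarrow> bool" where
  "has_dim f g n \<longleftrightarrow>
     ring.dimension (local_algebra f g) n (scalars f g) (carrier (local_algebra f g))"

definition intersection_number ::
    "complex fps fps \<Rightarrow> complex fps fps \<Rightarrow> enat" ("I\<^sub>0") where
  "I\<^sub>0 f g = (if \<exists>n. has_dim f g n then enat (THE n. has_dim f g n) else \<infinity>)"

end

theory Submission
  imports Defs
begin

text \<open>
  Write \<open>O\<close> for the ring of convergent series and \<open>codim I\<close> for the dimension of \<open>O / I\<close>. The
  intersection number with a product is computed by peeling off one coordinate at a time. If
  \<open>f(0,y)\<close> does not vanish identically, then \<open>x\<close>, which is a prime element, does not divide \<open>f\<close>.
  Therefore multiplication by \<open>x\<close> induces an injection of \<open>O / (f, h)\<close> into \<open>O / (f, x h)\<close> with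
  cokernel \<open>O / (f, x)\<close>, and \<open>codim (f, x h) = codim (f, h) + codim (f, x)\<close> for every \<open>h\<close>.
  This is \<open>rel_dim_ideal2_z_mult\<close>; the injectivity enters through \<open>rel_dim_multiply\<close>.

  The summand \<open>codim (f, x)\<close> is \<open>ell_y f\<close>: modulo \<open>x\<close> the series \<open>f\<close> becomes \<open>y ^ ell_y f\<close> times a
  unit, hence \<open>(f, x)\<close> consists of the series \<open>F\<close> for which \<open>F(0,y)\<close> vanishes to order at least
  \<open>ell_y f\<close> (\<open>ideal2_z_iff\<close>). Exchanging the coordinates gives \<open>ell_x f\<close> for each factor \<open>y\<close>. The
  induction starts at the ideal \<open>(f, U)\<close>, which is all of \<open>O\<close> because \<open>U\<close> is a unit.

  If \<open>f(0,y) = 0\<close> and \<open>x\<close> divides \<open>g\<close>, then \<open>(f, g)\<close> is contained in \<open>(x)\<close>. The powers of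
  \<open>y\<close> are linearly independent modulo \<open>(x)\<close>, and both sides of the formula are infinite
  (\<open>intersection_number_infinite\<close>). The case \<open>f(x,0) = 0\<close> with \<open>y\<close> dividing \<open>g\<close> is symmetric.

  Beyond closure under sums and products, only two facts about convergence enter: a series with
  nonzero constant term has a convergent inverse (\<open>convergent2_unit\<close>), and division by a
  coordinate preserves convergence (\<open>convergent2_shift2\<close>).
\<close>

section \<open>Growth of the coefficients\<close>

text \<open>
  Convergence is handled through Cauchy estimates: a series converges near the origin if and only
  if its coefficients are bounded by a geometric progression in the total degree. In this form it
  can be checked coefficient by coefficient.
\<close>
definition geometric_bound :: "complex fps fps \<Rightarrow> real \<Rightarrow> real \<Rightarrow> bool" where
  "geometric_bound F C M \<longleftrightarrow> (\<forall>i j. norm (coeff2 F i j) \<le> C * M ^ (i + j))"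

text \<open>
  The terms of an absolutely convergent series at one point with positive coordinates are bounded
  by the sum of their absolute values.
\<close>
lemma convergent2_imp_geometric_bound:
  assumes "convergent2 F"
  obtains C M where "C > 0" "M > 0" "geometric_bound F C M"
proof -
  obtain r where r: "r > 0" and summable:
    "\<And>x y. norm x < r \<Longrightarrow> norm y < r \<Longrightarrow> (\<lambda>(i, j). coeff2 F i j * x ^ i * y ^ j) summable_on UNIV"
    using assms unfolding convergent2_def by blast
  define t where "t = r / 2"
  have t: "t > 0" "t < r" using r by (auto simp: t_def)
  define a where "a = (\<lambda>(i, j). coeff2 F i j * complex_of_real t ^ i * complex_of_real t ^ j)"
  have "a summable_on UNIV"
    unfolding a_def by (rule summable) (use t in auto)
  then have abs: "(\<lambda>p. norm (a p)) summable_on UNIV"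
    by (simp add: summable_on_iff_abs_summable_on_complex)
  define C where "C = (\<Sum>\<^sub>\<infinity>p. norm (a p)) + 1"
  have le: "norm (a p) \<le> C" for p
    using finite_sum_le_infsum[OF abs, of "{p}"] by (simp add: C_def)
  have "norm (a (0, 0)) \<ge> 0" by simp
  then have "(\<Sum>\<^sub>\<infinity>p. norm (a p)) \<ge> 0" by (intro infsum_nonneg) auto
  then have "C > 0" by (simp add: C_def)
  moreover have "geometric_bound F C (1 / t)"
    unfolding geometric_bound_def
  proof (intro allI)
    fix i j
    have "norm (coeff2 F i j) * t ^ (i + j) \<le> C"
      using le[of "(i, j)"] t by (simp add: a_def norm_mult norm_power power_add mult.assoc)
    then show "norm (coeff2 F i j) \<le> C * (1 / t) ^ (i + j)"
      using t by (simp add: power_divide pos_le_divide_eq)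
  qed
  ultimately show thesis using that[of C "1 / t"] t by simp
qed

text \<open>
  In the polydisc of radius \<open>1 / M\<close> the series is dominated by a product of two geometric series.
\<close>
lemma geometric_bound_imp_convergent2:
  assumes "geometric_bound F C M" "M > 0"
  shows "convergent2 F"
  unfolding convergent2_def
proof (intro exI[of _ "1 / M"] conjI allI impI)
  show "1 / M > 0" using assms by simp
next
  fix x y :: complex
  assume x: "norm x < 1 / M" and y: "norm y < 1 / M"
  have geo: "(\<lambda>i. norm ((M * norm z) ^ i)) summable_on UNIV" if "norm z < 1 / M" for z :: complex
  proof -
    have "M * norm z < 1" using that assms(2) by (simp add: pos_less_divide_eq mult.commute)
    then show ?thesis
      using assms(2) by (subst summable_on_UNIV_nonneg_real_iff) (auto simp: norm_power intro!: summable_geometric)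
  qed
  have "(\<lambda>(i, j). (M * norm x) ^ i * (M * norm y) ^ j) abs_summable_on UNIV \<times> UNIV"
    unfolding abs_summable_on_Sigma_iff
    using geo[OF x] geo[OF y]
    by (simp add: norm_mult abs_mult infsum_cmult_right' summable_on_cmult_right summable_on_cmult_left)
  then have "(\<lambda>(i, j). C * ((M * norm x) ^ i * (M * norm y) ^ j)) abs_summable_on UNIV"
    by (auto dest!: summable_on_cmult_right[of _ _ "\<bar>C\<bar>"] simp: case_prod_unfold abs_mult)
  then have "(\<lambda>(i, j). coeff2 F i j * x ^ i * y ^ j) abs_summable_on UNIV"
  proof (rule abs_summable_on_comparison_test)
    fix p :: "nat \<times> nat"
    obtain i j where p: "p = (i, j)" by force
    have "norm (coeff2 F i j) * (norm x ^ i * norm y ^ j)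
        \<le> (C * M ^ (i + j)) * (norm x ^ i * norm y ^ j)"
      using assms(1) by (intro mult_right_mono) (auto simp: geometric_bound_def)
    also have "\<dots> = C * ((M * norm x) ^ i * (M * norm y) ^ j)"
      by (simp add: power_add power_mult_distrib)
    also have "\<dots> \<le> norm (C * ((M * norm x) ^ i * (M * norm y) ^ j))" by simp
    finally show "norm (case p of (i, j) \<Rightarrow> coeff2 F i j * x ^ i * y ^ j)
        \<le> norm (case p of (i, j) \<Rightarrow> C * ((M * norm x) ^ i * (M * norm y) ^ j))"
      by (simp add: p norm_mult norm_power mult.assoc)
  qed
  then show "(\<lambda>(i, j). coeff2 F i j * x ^ i * y ^ j) summable_on UNIV"
    by (rule abs_summable_summable)
qed

lemma geometric_bound_mono:
  assumes "geometric_bound F C M" "C \<le> C'" "0 < M" "M \<le> M'" "0 \<le> C"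
  shows "geometric_bound F C' M'"
  unfolding geometric_bound_def
proof (intro allI)
  fix i j
  have "norm (coeff2 F i j) \<le> C * M ^ (i + j)"
    using assms by (auto simp: geometric_bound_def)
  also have "\<dots> \<le> C' * M' ^ (i + j)"
    using assms by (intro mult_mono power_mono) auto
  finally show "norm (coeff2 F i j) \<le> C' * M' ^ (i + j)" .
qed

lemma common_geometric_bound:
  assumes "convergent2 F" "convergent2 G"
  obtains C M where "C > 0" "M > 0" "geometric_bound F C M" "geometric_bound G C M"
proof -
  obtain C M where 1: "C > 0" "M > 0" "geometric_bound F C M"
    using assms(1) by (rule convergent2_imp_geometric_bound)
  obtain C' M' where 2: "C' > 0" "M' > 0" "geometric_bound G C' M'"
    using assms(2) by (rule convergent2_imp_geometric_bound)
  show thesis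
    by (rule that[of "max C C'" "max M M'"])
      (use 1 2 in \<open>auto intro: geometric_bound_mono\<close>)
qed

section \<open>Closure properties of convergent series\<close>

lemma coeff2_add [simp]: "coeff2 (F + G) i j = coeff2 F i j + coeff2 G i j"
  and coeff2_zero [simp]: "coeff2 0 i j = 0"
  by (simp_all add: coeff2_def)

lemma coeff2_one: "coeff2 1 i j = (if i = 0 \<and> j = 0 then 1 else 0)"
  by (simp add: coeff2_def)

lemma coeff2_const2: "coeff2 (const2 c) i j = (if i = 0 \<and> j = 0 then c else 0)"
  by (simp add: coeff2_def const2_def)

lemma coeff2_mult:
  "coeff2 (F * G) i j = (\<Sum>(k, l)\<in>{..i} \<times> {..j}. coeff2 F k l * coeff2 G (i - k) (j - l))"
  by (simp add: coeff2_def fps_mult_nth fps_sum_nth sum.cartesian_product[symmetric]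
      atLeast0AtMost sum.swap[of _ "{..i}"])

lemma coeff2_eqI: "(\<And>i j. coeff2 F i j = coeff2 G i j) \<Longrightarrow> F = G"
  by (intro fps_ext) (simp add: coeff2_def)

lemma convergent2_const2: "convergent2 (const2 c)"
  by (rule geometric_bound_imp_convergent2[of _ "norm c" 1])
    (auto simp: geometric_bound_def coeff2_const2)

lemma const2_simps: "const2 0 = 0" "const2 1 = 1"
    "const2 (a + b) = const2 a + const2 b" "const2 (a * b) = const2 a * const2 b"
    "const2 (- a) = - const2 a"
  by (simp_all add: const2_def)

lemma convergent2_var_x: "convergent2 var_x"
  by (rule geometric_bound_imp_convergent2[of _ 1 1])
    (auto simp: geometric_bound_def coeff2_def var_x_def fps_X_def)

lemma convergent2_var_y: "convergent2 var_y"
  by (rule geometric_bound_imp_convergent2[of _ 1 1])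
    (auto simp: geometric_bound_def coeff2_def var_y_def fps_X_def)

lemma convergent2_add:
  assumes "convergent2 F" "convergent2 G"
  shows "convergent2 (F + G)"
proof -
  obtain C M where M: "M > 0" and F: "geometric_bound F C M" and G: "geometric_bound G C M"
    using assms by (rule common_geometric_bound)
  have "geometric_bound (F + G) (2 * C) M"
    unfolding geometric_bound_def
  proof (intro allI)
    fix i j
    have "norm (coeff2 (F + G) i j) \<le> norm (coeff2 F i j) + norm (coeff2 G i j)"
      by (simp add: norm_triangle_ineq)
    also have "\<dots> \<le> 2 * C * M ^ (i + j)"
      using F G unfolding geometric_bound_def
      by (metis add_mono mult.assoc mult_2)
    finally show "norm (coeff2 (F + G) i j) \<le> 2 * C * M ^ (i + j)" .
  qed
  then show ?thesis using M by (rule geometric_bound_imp_convergent2)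
qed

lemma convergent2_mult:
  assumes "convergent2 F" "convergent2 G"
  shows "convergent2 (F * G)"
proof -
  obtain C M where C: "C > 0" and M: "M > 0"
    and F: "geometric_bound F C M" and G: "geometric_bound G C M"
    using assms by (rule common_geometric_bound)
  have "geometric_bound (F * G) (C * C) (2 * M)"
    unfolding geometric_bound_def
  proof (intro allI)
    fix i j
    have "norm (coeff2 (F * G) i j)
        \<le> (\<Sum>(k, l)\<in>{..i} \<times> {..j}. norm (coeff2 F k l) * norm (coeff2 G (i - k) (j - l)))"
      unfolding coeff2_mult
      by (rule order.trans[OF norm_sum]) (simp add: case_prod_unfold norm_mult)
    also have "\<dots> \<le> (\<Sum>(k, l)\<in>{..i} \<times> {..j}. C * C * M ^ (i + j))"
    proof (rule sum_mono, clarsimp)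
      fix k l assume kl: "k \<le> i" "l \<le> j"
      have "norm (coeff2 F k l) * norm (coeff2 G (i - k) (j - l))
          \<le> (C * M ^ (k + l)) * (C * M ^ ((i - k) + (j - l)))"
        using F G C M unfolding geometric_bound_def by (intro mult_mono) auto
      also have "\<dots> = C * C * M ^ ((k + l) + ((i - k) + (j - l)))"
        by (simp add: power_add)
      also have "(k + l) + ((i - k) + (j - l)) = i + j" using kl by simp
      finally show "norm (coeff2 F k l) * norm (coeff2 G (i - k) (j - l)) \<le> C * C * M ^ (i + j)" .
    qed
    \<comment> \<open>The number of summands is absorbed by doubling the ratio of the geometric bound.\<close>
    also have "\<dots> = real (Suc i) * real (Suc j) * (C * C * M ^ (i + j))"
      by (simp only: sum_constant card_cartesian_product card_atMost case_prod_unfold of_nat_mult)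
    also have "\<dots> \<le> (2 ^ i * 2 ^ j) * (C * C * M ^ (i + j))"
    proof -
      have "real (Suc n) \<le> 2 ^ n" for n
        using of_nat_mono[OF Suc_leI[OF less_exp[of n]], where 'a = real] by simp
      then show ?thesis using C M by (intro mult_right_mono mult_mono) auto
    qed
    also have "\<dots> = C * C * (2 * M) ^ (i + j)"
      by (simp add: power_add power_mult_distrib)
    finally show "norm (coeff2 (F * G) i j) \<le> C * C * (2 * M) ^ (i + j)" .
  qed
  then show ?thesis using M by (intro geometric_bound_imp_convergent2[of _ "C * C" "2 * M"]) auto
qed

lemma convergent2_uminus: "convergent2 F \<Longrightarrow> convergent2 (- F)"
  using convergent2_mult[OF convergent2_const2[of "-1"], of F]
  by (simp add: const2_simps)

lemma convergent2_diff: "convergent2 F \<Longrightarrow> convergent2 G \<Longrightarrow> convergent2 (F - G)"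
  using convergent2_add[OF _ convergent2_uminus, of F G] by simp

lemma convergent2_power: "convergent2 F \<Longrightarrow> convergent2 (F ^ n)"
  by (induction n) (auto intro: convergent2_mult simp: convergent2_const2[of 1, unfolded const2_simps])

text \<open>
  The left-hand side majorises the part of positive degree of a series with geometrically bounded
  coefficients. That it is \<open>O(q)\<close>, uniformly in \<open>i\<close> and \<open>j\<close>, is what makes the recursion for the
  coefficients of an inverse contracting.
\<close>
lemma sum_punctured_geometric_le:
  fixes q :: real
  assumes "0 \<le> q" "q \<le> 1 / 2"
  shows "(\<Sum>(k, l)\<in>{..i} \<times> {..j} - {(0, 0)}. q ^ (k + l)) \<le> 8 * q"
proof -
  have geo: "(\<Sum>k\<le>n. q ^ k) \<le> 1 + 2 * q" for n
  proof -
    have "(\<Sum>k\<le>n. q ^ k) = (1 - q ^ Suc n) / (1 - q)"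
      using assms sum_gp0[of q n] by auto
    also have "\<dots> \<le> 1 / (1 - q)" using assms by (intro divide_right_mono) auto
    also have "\<dots> \<le> 1 + 2 * q"
    proof -
      have "q * (2 * q) \<le> q * 1" using assms by (intro mult_left_mono) auto
      then have "1 \<le> (1 + 2 * q) * (1 - q)" by (simp add: algebra_simps)
      then show ?thesis using assms by (subst pos_divide_le_eq) auto
    qed
    finally show ?thesis .
  qed
  have "1 + (\<Sum>(k, l)\<in>{..i} \<times> {..j} - {(0, 0)}. q ^ (k + l)) = (\<Sum>(k, l)\<in>{..i} \<times> {..j}. q ^ (k + l))"
    by (subst sum.remove[of _ "(0, 0)"]) auto
  also have "\<dots> = (\<Sum>k\<le>i. q ^ k) * (\<Sum>l\<le>j. q ^ l)"
    by (simp add: sum_product power_add flip: sum.cartesian_product)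
  also have "\<dots> \<le> (1 + 2 * q) * (1 + 2 * q)"
    using assms by (intro mult_mono geo sum_nonneg) auto
  also have "\<dots> = 1 + 4 * q + 4 * q * q" by (simp add: algebra_simps)
  also have "\<dots> \<le> 1 + 8 * q"
    using mult_left_mono[of q "1/2" "q"] assms by simp
  finally show ?thesis by simp
qed

text \<open>
  The formal inverse satisfies a recursion that expresses each coefficient through those of lower
  degree. Suppose that the coefficients of the series and of its inverse up to some degree have
  geometric bounds with ratios \<open>M\<close> and \<open>N\<close>. Then one step of the recursion costs a factor of at most
  \<open>C / norm (value0 F)\<close> times the sum of \<open>(M / N) ^ (k + l)\<close> over all \<open>(k, l) \<noteq> (0, 0)\<close>. For \<open>N\<close>
  sufficiently large this factor is at most \<open>1\<close>, and the bound propagates by induction on the degree.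
\<close>
lemma convergent2_unit:
  assumes F: "convergent2 F" and F0: "value0 F \<noteq> 0"
  obtains G where "convergent2 G" "F * G = 1"
proof -
  define G where "G = fps_right_inverse F (inverse (fps_nth F 0))"
  have FG: "F * G = 1"
    unfolding G_def using F0
    by (intro fps_right_inverse inverse_mult_eq_1') (simp add: value0_def coeff2_def)
  define a where "a = norm (value0 F)"
  have a: "a > 0" using F0 by (simp add: a_def)
  obtain C M where C: "C > 0" and M: "M > 0" and bound: "geometric_bound F C M"
    using F by (rule convergent2_imp_geometric_bound)
  \<comment> \<open>Here \<open>C / a\<close> times \<open>8 * q\<close>, the bound on the punctured sum, is at most \<open>1\<close>.\<close>
  define q where "q = min (1 / 2) (a / (8 * C))"
  have q: "0 < q" "q \<le> 1 / 2" "8 * q * C \<le> a"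
    using a C by (auto simp: q_def min_def field_simps)
  define N where "N = M / q"
  have N: "N > 0" "M = q * N" using M q by (auto simp: N_def)
  have "norm (coeff2 G i j) \<le> inverse a * N ^ (i + j)" for i j
  proof (induction "i + j" arbitrary: i j rule: less_induct)
    case less
    define S where "S = {..i} \<times> {..j} - {(0, 0)}"
    have "coeff2 (F * G) i j =
        value0 F * coeff2 G i j + (\<Sum>(k, l)\<in>S. coeff2 F k l * coeff2 G (i - k) (j - l))"
      unfolding coeff2_mult S_def by (subst sum.remove[of _ "(0, 0)"]) (auto simp: value0_def)
    then have rec: "value0 F * coeff2 G i j =
        coeff2 1 i j - (\<Sum>(k, l)\<in>S. coeff2 F k l * coeff2 G (i - k) (j - l))"
      by (simp add: FG)
    show ?case
    proof (cases "i + j = 0")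
      case True
      then have "value0 F * coeff2 G i j = 1" using rec by (simp add: S_def coeff2_one)
      then have "a * norm (coeff2 G i j) = 1" by (metis a_def norm_mult norm_one)
      then show ?thesis using a True by (simp add: field_simps)
    next
      case False
      then have "value0 F * coeff2 G i j = - (\<Sum>(k, l)\<in>S. coeff2 F k l * coeff2 G (i - k) (j - l))"
        using rec by (auto simp: coeff2_one)
      then have "norm (value0 F * coeff2 G i j)
          = norm (\<Sum>(k, l)\<in>S. coeff2 F k l * coeff2 G (i - k) (j - l))"
        by simp
      then have "a * norm (coeff2 G i j)
          = norm (\<Sum>(k, l)\<in>S. coeff2 F k l * coeff2 G (i - k) (j - l))"
        by (simp only: a_def norm_mult)
      also have "\<dots> \<le> (\<Sum>(k, l)\<in>S. norm (coeff2 F k l) * norm (coeff2 G (i - k) (j - l)))"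
        by (rule order.trans[OF norm_sum]) (simp add: case_prod_unfold norm_mult)
      also have "\<dots> \<le> (\<Sum>(k, l)\<in>S. C * inverse a * N ^ (i + j) * q ^ (k + l))"
      proof (rule sum_mono, clarify)
        fix k l assume kl: "(k, l) \<in> S"
        then have le: "k \<le> i" "l \<le> j" "k + l > 0" by (auto simp: S_def)
        have "norm (coeff2 F k l) * norm (coeff2 G (i - k) (j - l))
            \<le> (C * (q * N) ^ (k + l)) * (inverse a * N ^ ((i - k) + (j - l)))"
          using bound le C N q less[of "i - k" "j - l"]
          by (intro mult_mono) (auto simp: geometric_bound_def)
        also have "\<dots> = C * inverse a * N ^ ((k + l) + ((i - k) + (j - l))) * q ^ (k + l)"
          by (simp add: power_add power_mult_distrib)
        also have "(k + l) + ((i - k) + (j - l)) = i + j" using le by simp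
        finally show "norm (coeff2 F k l) * norm (coeff2 G (i - k) (j - l))
            \<le> C * inverse a * N ^ (i + j) * q ^ (k + l)" .
      qed
      also have "\<dots> = C * inverse a * N ^ (i + j) * (\<Sum>(k, l)\<in>S. q ^ (k + l))"
        by (simp add: sum_distrib_left case_prod_unfold)
      also have "\<dots> \<le> C * inverse a * N ^ (i + j) * (8 * q)"
        unfolding S_def using q C a N by (intro mult_left_mono sum_punctured_geometric_le) auto
      also have "\<dots> = (8 * q * C) * (inverse a * N ^ (i + j))" by simp
      also have "\<dots> \<le> a * (inverse a * N ^ (i + j))"
        using q a N by (intro mult_right_mono) auto
      finally show ?thesis using a by simp
    qed
  qed
  then have "geometric_bound G (inverse a) N" by (simp add: geometric_bound_def)
  then have "convergent2 G" using N(1) by (rule geometric_bound_imp_convergent2)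
  then show thesis using FG that by blast
qed

section \<open>Division by the coordinates\<close>

text \<open>
  The quotient of the series by the monomial \<open>x ^ a * y ^ b\<close>, with all terms that this monomial
  does not divide discarded.
\<close>
definition shift2 :: "nat \<Rightarrow> nat \<Rightarrow> complex fps fps \<Rightarrow> complex fps fps" where
  "shift2 a b F = Abs_fps (\<lambda>j. Abs_fps (\<lambda>i. coeff2 F (i + a) (j + b)))"

lemma coeff2_shift2 [simp]: "coeff2 (shift2 a b F) i j = coeff2 F (i + a) (j + b)"
  by (simp add: coeff2_def shift2_def)

text \<open>
  Shifting the exponents changes a geometric bound only by the constant factor \<open>M ^ (a + b)\<close>.
\<close>
lemma convergent2_shift2:
  assumes "convergent2 F"
  shows "convergent2 (shift2 a b F)"
proof -
  obtain C M where "C > 0" and M: "M > 0" and "geometric_bound F C M"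
    using assms by (rule convergent2_imp_geometric_bound)
  then have "norm (coeff2 F (i + a) (j + b)) \<le> C * M ^ ((i + a) + (j + b))" for i j
    unfolding geometric_bound_def by blast
  then have "geometric_bound (shift2 a b F) (C * M ^ (a + b)) M"
    by (simp add: geometric_bound_def power_add mult_ac)
  then show ?thesis using M by (rule geometric_bound_imp_convergent2)
qed

lemma coeff2_var_x_mult: "coeff2 (var_x * F) i j = (if i = 0 then 0 else coeff2 F (i - 1) j)"
  by (simp add: coeff2_def var_x_def)

lemma coeff2_var_y_mult: "coeff2 (var_y * F) i j = (if j = 0 then 0 else coeff2 F i (j - 1))"
  by (simp add: coeff2_def var_y_def)

lemma var_x_nonzero: "var_x \<noteq> 0" and var_y_nonzero: "var_y \<noteq> 0"
  by (simp_all add: var_x_def var_y_def)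

lemma restrict_y_axis_simps:
  "restrict_y_axis (F + G) = restrict_y_axis F + restrict_y_axis G"
  "restrict_y_axis (F * G) = restrict_y_axis F * restrict_y_axis G"
  "restrict_y_axis (const2 c) = fps_const c"
  "restrict_y_axis var_x = 0" "restrict_y_axis var_y = fps_X"
  "fps_nth (restrict_y_axis F) 0 = value0 F"
  by (simp_all add: fps_eq_iff restrict_y_axis_def coeff2_def fps_mult_nth fps_sum_nth
      const2_def var_x_def var_y_def value0_def fps_X_def)

lemma restrict_x_axis_simps:
  "restrict_x_axis (F + G) = restrict_x_axis F + restrict_x_axis G"
  "restrict_x_axis (F * G) = restrict_x_axis F * restrict_x_axis G"
  "restrict_x_axis (const2 c) = fps_const c"
  "restrict_x_axis var_y = 0" "restrict_x_axis var_x = fps_X"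
  "fps_nth (restrict_x_axis F) 0 = value0 F"
  by (simp_all add: fps_eq_iff restrict_x_axis_def coeff2_def fps_mult_nth
      const2_def var_x_def var_y_def value0_def)

section \<open>The ring of convergent series\<close>

lemma conv_series_simps [simp]:
  "carrier \<complex>xy = {F. convergent2 F}" "monoid.mult \<complex>xy = (*)" "monoid.one \<complex>xy = 1" "ring.zero \<complex>xy = 0"
  "add \<complex>xy = (+)"
  by (simp_all add: conv_series_def)

lemma convergent2_zero: "convergent2 0" and convergent2_one: "convergent2 1"
  using convergent2_const2[of 0] convergent2_const2[of 1] by (simp_all add: const2_simps)

lemma cring_conv_series: "cring \<complex>xy"
proof (rule cringI)
  show "abelian_group \<complex>xy"
  proof (rule abelian_groupI)
    fix F assume "F \<in> carrier \<complex>xy"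
    then show "\<exists>G\<in>carrier \<complex>xy. G \<oplus>\<^bsub>\<complex>xy\<^esub> F = \<zero>\<^bsub>\<complex>xy\<^esub>"
      by (intro bexI[of _ "- F"]) (auto intro: convergent2_uminus)
  qed (auto intro: convergent2_add convergent2_zero)
  show "Group.comm_monoid \<complex>xy"
    by (rule comm_monoidI) (auto intro: convergent2_mult convergent2_one)
qed (auto simp: algebra_simps)

interpretation conv: cring "\<complex>xy"
  by (rule cring_conv_series)

lemma conv_minus [simp]: "convergent2 F \<Longrightarrow> \<ominus>\<^bsub>\<complex>xy\<^esub> F = - F"
  by (rule conv.add.inv_equality) (auto intro: convergent2_uminus)

lemma conv_pow [simp]: "F [^]\<^bsub>\<complex>xy\<^esub> (n::nat) = F ^ n"
  by (induction n) auto

abbreviation complex_constants :: "complex fps fps set" where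
  "complex_constants \<equiv> range const2"

text \<open>
  Dimensions in the quotient are taken over the image of this subfield.
\<close>
lemma subfield_complex_constants: "subfield complex_constants \<complex>xy"
proof (rule conv.subfieldI)
  have "subring complex_constants \<complex>xy"
  proof (rule conv.subringI)
    show "complex_constants \<subseteq> carrier \<complex>xy" by (auto simp: convergent2_const2)
    show "\<one>\<^bsub>\<complex>xy\<^esub> \<in> complex_constants"
      using const2_simps(2) by (metis conv_series_simps(3) rangeI)
  qed (auto simp: convergent2_const2 simp flip: const2_simps)
  then show "subcring complex_constants \<complex>xy"
    by (rule conv.subcringI')
next
  let ?K = "\<complex>xy \<lparr>carrier := complex_constants\<rparr>"
  have "const2 c \<in> Units ?K" if "c \<noteq> 0" for c
  proof -
    have "const2 (inverse c) * const2 c = 1" "const2 c * const2 (inverse c) = 1"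
      using that by (simp_all add: const2_simps(2) flip: const2_simps(4))
    then show ?thesis unfolding Units_def by auto
  qed
  moreover have "const2 c \<noteq> 0 \<longleftrightarrow> c \<noteq> 0" for c
    by (simp add: const2_def)
  ultimately have "complex_constants - {0} \<subseteq> Units ?K" by blast
  moreover have "Units ?K \<subseteq> complex_constants - {0}"
    by (auto simp: Units_def)
  ultimately show "Units ?K = complex_constants - {\<zero>\<^bsub>\<complex>xy\<^esub>}" by auto
qed

section \<open>Relative dimension\<close>

definition linear_subspace :: "complex fps fps set \<Rightarrow> bool" where
  "linear_subspace E \<longleftrightarrow> E \<subseteq> {F. convergent2 F} \<and> 0 \<in> E \<and>
    (\<forall>F\<in>E. \<forall>G\<in>E. F + G \<in> E) \<and> (\<forall>F\<in>E. \<forall>c. const2 c * F \<in> E)"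

lemma linear_subspaceD:
  assumes "linear_subspace E"
  shows "F \<in> E \<Longrightarrow> convergent2 F" "0 \<in> E" "F \<in> E \<Longrightarrow> G \<in> E \<Longrightarrow> F + G \<in> E"
    "F \<in> E \<Longrightarrow> const2 c * F \<in> E" "F \<in> E \<Longrightarrow> - F \<in> E" "F \<in> E \<Longrightarrow> G \<in> E \<Longrightarrow> F - G \<in> E"
proof -
  show *: "F \<in> E \<Longrightarrow> convergent2 F" "0 \<in> E" "\<And>G. F \<in> E \<Longrightarrow> G \<in> E \<Longrightarrow> F + G \<in> E"
    "\<And>F c. F \<in> E \<Longrightarrow> const2 c * F \<in> E"
    using assms by (auto simp: linear_subspace_def)
  show **: "- F \<in> E" if "F \<in> E" for F using *(4)[OF that, of "-1"] by (simp add: const2_simps)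
  show "F \<in> E \<Longrightarrow> G \<in> E \<Longrightarrow> F - G \<in> E" using *(3)[of "- G"] **[of G] by simp
qed

definition add_line :: "complex fps fps \<Rightarrow> complex fps fps set \<Rightarrow> complex fps fps set" where
  "add_line v E = {const2 c * v + w |c w. w \<in> E}"

text \<open>
  The relation \<open>rel_dim E n F\<close> expresses that \<open>F\<close> is the sum of \<open>E\<close> and \<open>n\<close> lines, each of them not
  contained in the sum of \<open>E\<close> and the lines added before. For subspaces it says that \<open>F / E\<close> has
  dimension \<open>n\<close>. Chains inside \<open>O\<close> are easier to transport along multiplication by an element than
  bases of quotients by varying ideals.
\<close>
inductive rel_dim :: "complex fps fps set \<Rightarrow> nat \<Rightarrow> complex fps fps set \<Rightarrow> bool"
  for E where
  rel_dim_refl: "rel_dim E 0 E"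
| rel_dim_step: "convergent2 v \<Longrightarrow> v \<notin> F \<Longrightarrow> rel_dim E n F \<Longrightarrow> rel_dim E (Suc n) (add_line v F)"

lemma subset_add_line: "E \<subseteq> add_line v E"
proof
  fix w assume "w \<in> E"
  then have "w = const2 0 * v + w \<and> w \<in> E" by (simp add: const2_simps)
  then show "w \<in> add_line v E" unfolding add_line_def by blast
qed

lemma linear_subspace_add_line:
  assumes "linear_subspace E" "convergent2 v"
  shows "linear_subspace (add_line v E)"
proof -
  note E = linear_subspaceD[OF assms(1)]
  have "F + G \<in> add_line v E" if FG: "F \<in> add_line v E" "G \<in> add_line v E" for F G
  proof -
    obtain c w c' w' where "F = const2 c * v + w" "w \<in> E" "G = const2 c' * v + w'" "w' \<in> E"
      using FG unfolding add_line_def by blast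
    then have "F + G = const2 (c + c') * v + (w + w')" "w + w' \<in> E"
      by (auto simp: const2_simps algebra_simps E)
    then show ?thesis unfolding add_line_def by blast
  qed
  moreover have "const2 a * F \<in> add_line v E" if F: "F \<in> add_line v E" for F a
  proof -
    obtain c w where "F = const2 c * v + w" "w \<in> E"
      using F by (auto simp: add_line_def)
    then have "const2 a * F = const2 (a * c) * v + const2 a * w" "const2 a * w \<in> E"
      using E(4) by (auto simp: const2_simps distrib_left mult.assoc)
    then show ?thesis unfolding add_line_def by blast
  qed
  moreover have "convergent2 F" if "F \<in> add_line v E" for F
    using that assms(2) E(1) unfolding add_line_def
    by (auto intro: convergent2_add convergent2_mult convergent2_const2)
  ultimately show ?thesis
    using subset_add_line[of E v] E(2) unfolding linear_subspace_def by blast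
qed

lemma rel_dim_linear_subspace:
  assumes "rel_dim E n F" "linear_subspace E"
  shows "linear_subspace F \<and> E \<subseteq> F"
  using assms
proof (induction rule: rel_dim.induct)
  case (rel_dim_step v F n)
  then show ?case using linear_subspace_add_line subset_add_line[of F v] by auto
qed auto

text \<open>
  This is the additivity of dimension in the exact sequence \<open>0 \<rightarrow> F / E \<rightarrow> G / E \<rightarrow> G / F \<rightarrow> 0\<close>.
\<close>
lemma rel_dim_trans:
  assumes "rel_dim F m G" "rel_dim E n F"
  shows "rel_dim E (n + m) G"
  using assms by (induction rule: rel_dim.induct) (auto intro: rel_dim.intros)

section \<open>Ideals with two generators\<close>

definition ideal2 :: "complex fps fps \<Rightarrow> complex fps fps \<Rightarrow> complex fps fps set" where
  "ideal2 f g = {f * p + g * q |p q. convergent2 p \<and> convergent2 q}"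

lemma ideal2I: "convergent2 p \<Longrightarrow> convergent2 q \<Longrightarrow> f * p + g * q \<in> ideal2 f g"
  unfolding ideal2_def by blast

lemma ideal2_props:
  assumes f: "convergent2 f" and g: "convergent2 g"
  shows "F \<in> ideal2 f g \<Longrightarrow> convergent2 F" "f \<in> ideal2 f g" "g \<in> ideal2 f g"
    "F \<in> ideal2 f g \<Longrightarrow> G \<in> ideal2 f g \<Longrightarrow> F + G \<in> ideal2 f g"
    "F \<in> ideal2 f g \<Longrightarrow> convergent2 p \<Longrightarrow> p * F \<in> ideal2 f g"
proof -
  show "F \<in> ideal2 f g \<Longrightarrow> convergent2 F"
    using f g by (auto simp: ideal2_def intro: convergent2_add convergent2_mult)
  show "f \<in> ideal2 f g" "g \<in> ideal2 f g"
    using ideal2I[OF convergent2_one convergent2_zero, of f g]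
      ideal2I[OF convergent2_zero convergent2_one, of f g] by simp_all
  show "F + G \<in> ideal2 f g" if FG: "F \<in> ideal2 f g" "G \<in> ideal2 f g"
  proof -
    obtain p q p' q' where "convergent2 p" "convergent2 q" "convergent2 p'" "convergent2 q'"
      "F = f * p + g * q" "G = f * p' + g * q'" using FG unfolding ideal2_def by blast
    then show ?thesis using ideal2I[of "p + p'" "q + q'" f g]
      by (simp add: algebra_simps convergent2_add)
  qed
  show "p * F \<in> ideal2 f g" if F: "F \<in> ideal2 f g" and p: "convergent2 p"
  proof -
    obtain a b where "convergent2 a" "convergent2 b" "F = f * a + g * b"
      using F by (auto simp: ideal2_def)
    then show ?thesis using ideal2I[of "p * a" "p * b" f g] p
      by (simp add: algebra_simps convergent2_mult)
  qed
qed

lemma linear_subspace_ideal2: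
  assumes "convergent2 f" "convergent2 g"
  shows "linear_subspace (ideal2 f g)"
  unfolding linear_subspace_def using ideal2_props[OF assms] ideal2_props(5)[OF assms, of f 0]
  by (auto simp: convergent2_zero convergent2_const2)

lemma genideal_eq_ideal2:
  assumes "convergent2 f" "convergent2 g"
  shows "genideal \<complex>xy {f, g} = ideal2 f g"
proof (rule antisym)
  note I = ideal2_props[OF assms]
  have sub: "subgroup (ideal2 f g) (add_monoid \<complex>xy)"
    by (rule conv.add.subgroupI)
      (use I linear_subspaceD[OF linear_subspace_ideal2[OF assms]] in
        \<open>auto simp: a_inv_def[symmetric]\<close>)
  have "ideal (ideal2 f g) \<complex>xy"
    by (rule idealI[OF conv.ring_axioms sub]) (use I(5) in \<open>auto simp: mult.commute\<close>)
  then show "genideal \<complex>xy {f, g} \<subseteq> ideal2 f g"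
    by (rule conv.genideal_minimal) (use I in auto)
  have "ideal (genideal \<complex>xy {f, g}) \<complex>xy"
    using assms by (intro conv.genideal_ideal) auto
  then interpret G: ideal "genideal \<complex>xy {f, g}" "\<complex>xy" .
  have "f \<in> genideal \<complex>xy {f, g}" "g \<in> genideal \<complex>xy {f, g}"
    using conv.genideal_self[of "{f, g}"] assms by auto
  then show "ideal2 f g \<subseteq> genideal \<complex>xy {f, g}"
    using G.I_r_closed[of f] G.I_r_closed[of g] G.a_closed by (auto simp: ideal2_def)
qed

text \<open>
  Multiplication by \<open>z\<close> maps \<open>B / A\<close> onto \<open>(z B + f O) / (z A + f O)\<close>. The map is injective: if
  \<open>z * v = z * b + f * p\<close>, then \<open>z\<close> divides \<open>f * p\<close>, hence \<open>p\<close>, and cancelling \<open>z\<close> leaves \<open>v - b\<close> in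
  \<open>f O\<close>, which is contained in \<open>A\<close>. The hypothesis \<open>prime\<close> holds when \<open>z\<close> is prime and does not
  divide \<open>f\<close>.
\<close>
lemma rel_dim_multiply:
  assumes "rel_dim A n B"
    and A: "linear_subspace A" and z: "convergent2 z" "z \<noteq> 0"
    and fA: "\<And>p. convergent2 p \<Longrightarrow> f * p \<in> A"
    and prime: "\<And>p F. convergent2 p \<Longrightarrow> convergent2 F \<Longrightarrow> f * p = z * F \<Longrightarrow> \<exists>p'. convergent2 p' \<and> p = z * p'"
  defines "S \<equiv> \<lambda>B. {z * b + f * p |b p. b \<in> B \<and> convergent2 p}"
  shows "rel_dim (S A) n (S B)"
  using assms(1)
proof (induction rule: rel_dim.induct)
  case rel_dim_refl
  show ?case by (rule rel_dim.rel_dim_refl)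
next
  case (rel_dim_step v F n)
  have F: "linear_subspace F" "A \<subseteq> F" using rel_dim_linear_subspace[OF rel_dim_step(3) A] by auto
  note F' = linear_subspaceD[OF F(1)]
  have "z * v \<notin> S F"
  proof
    assume "z * v \<in> S F"
    then obtain b p where b: "b \<in> F" "convergent2 p" "z * v = z * b + f * p" by (auto simp: S_def)
    then have "f * p = z * (v - b)" by (simp add: algebra_simps)
    then obtain p' where p': "convergent2 p'" "p = z * p'"
      using prime[of p "v - b"] b rel_dim_step(1) F' by (auto simp: convergent2_diff)
    then have "z * v = z * (b + f * p')" using b(3) by (simp add: algebra_simps)
    then have "v = b + f * p'" using z(2) by simp
    moreover have "b + f * p' \<in> F" using b fA[OF p'(1)] F(2) F' by auto
    ultimately show False using rel_dim_step(2) by simp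
  qed
  moreover have "S (add_line v F) = add_line (z * v) (S F)"
  proof -
    have eq: "z * (const2 c * v + w) + f * p = const2 c * (z * v) + (z * w + f * p)" for c w p
      by (simp add: algebra_simps)
    have "G \<in> S (add_line v F) \<longleftrightarrow>
        (\<exists>c w p. w \<in> F \<and> convergent2 p \<and> G = const2 c * (z * v) + (z * w + f * p))" for G
      unfolding S_def add_line_def by (simp flip: eq) blast
    moreover have "G \<in> add_line (z * v) (S F) \<longleftrightarrow>
        (\<exists>c w p. w \<in> F \<and> convergent2 p \<and> G = const2 c * (z * v) + (z * w + f * p))" for G
      unfolding S_def add_line_def by blast
    ultimately show ?thesis by blast
  qed
  ultimately show ?case
    using rel_dim.rel_dim_step[of "z * v" "S F" "S A" n] rel_dim_step z
    by (simp add: convergent2_mult)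
qed

lemma ideal_ideal2:
  assumes "convergent2 f" "convergent2 g"
  shows "ideal (ideal2 f g) \<complex>xy"
  using conv.genideal_ideal[of "{f, g}"] assms by (simp add: genideal_eq_ideal2)

section \<open>Dimension of the quotient\<close>

text \<open>
  A line that is not contained in a subspace \<open>F\<close> with \<open>I \<subseteq> F\<close> has an image in the quotient that is
  not contained in the image of \<open>F\<close>. Therefore a chain from \<open>I\<close> to \<open>F\<close> maps to a chain from zero
  to the image of \<open>F\<close>.
\<close>
lemma rel_dim_imp_dimension:
  assumes I: "ideal I \<complex>xy" and sub: "linear_subspace I" and "rel_dim I n F"
  shows "ring.dimension (\<complex>xy Quot I) n ((+>\<^bsub>\<complex>xy\<^esub>) I ` complex_constants) ((+>\<^bsub>\<complex>xy\<^esub>) I ` F)"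
proof -
  interpret I: ideal I "\<complex>xy" by (rule I)
  interpret h: ring_hom_ring "\<complex>xy" "\<complex>xy Quot I" "(+>\<^bsub>\<complex>xy\<^esub>) I" by (rule I.rcos_ring_hom_ring)
  let ?h = "(+>\<^bsub>\<complex>xy\<^esub>) I"
  show ?thesis
    using assms(3)
  proof (induction rule: rel_dim.induct)
    case rel_dim_refl
    have "?h w = I" if "w \<in> I" for w using I.a_rcos_const that by blast
    then have "?h ` I = {\<zero>\<^bsub>\<complex>xy Quot I\<^esub>}"
      using I.zero_closed by (auto simp: FactRing_def image_iff)
    then show ?case using h.S.dimension.zero_dim by simp
  next
    case (rel_dim_step v F n)
    have F: "linear_subspace F" "I \<subseteq> F" using rel_dim_linear_subspace[OF rel_dim_step(3) sub] by auto
    note F' = linear_subspaceD[OF F(1)]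
    have hv: "?h v \<notin> ?h ` F"
    proof
      assume "?h v \<in> ?h ` F"
      then obtain w where w: "w \<in> F" "?h v = ?h w" by auto
      then have "v \<in> ?h w" using I.a_rcos_self[of v] rel_dim_step(1) by auto
      then obtain i where "i \<in> I" "v = i + w" by (auto simp: a_r_coset_def')
      then show False using F F' w rel_dim_step(2) by auto
    qed
    have "h.S.line_extension (?h ` complex_constants) (?h v) (?h ` F) = ?h ` add_line v F"
    proof -
      have eq: "?h (const2 c) \<otimes>\<^bsub>\<complex>xy Quot I\<^esub> ?h v \<oplus>\<^bsub>\<complex>xy Quot I\<^esub> ?h w = ?h (const2 c * v + w)"
        if "w \<in> F" for c w
        using h.hom_add[of "const2 c * v" w] h.hom_mult[of "const2 c" v] F'(1)[OF that] rel_dim_step(1)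
        by (simp add: convergent2_mult convergent2_const2)
      have "G \<in> h.S.line_extension (?h ` complex_constants) (?h v) (?h ` F) \<longleftrightarrow>
          (\<exists>c. \<exists>w\<in>F. G = ?h (const2 c) \<otimes>\<^bsub>\<complex>xy Quot I\<^esub> ?h v \<oplus>\<^bsub>\<complex>xy Quot I\<^esub> ?h w)" for G
        unfolding h.S.line_extension_mem_iff by blast
      then have "G \<in> h.S.line_extension (?h ` complex_constants) (?h v) (?h ` F) \<longleftrightarrow>
          (\<exists>c. \<exists>w\<in>F. G = ?h (const2 c * v + w))" for G
        by (simp only: eq cong: bex_cong)
      moreover have "G \<in> ?h ` add_line v F \<longleftrightarrow> (\<exists>c. \<exists>w\<in>F. G = ?h (const2 c * v + w))" for G
        unfolding add_line_def by blast
      ultimately show ?thesis by (intro Set.set_eqI) (simp only:)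
    qed
    then show ?case
      using h.S.dimension.Suc_dim[OF _ hv rel_dim_step(4)] h.hom_closed[of v] rel_dim_step(1) by simp
  qed
qed

lemma local_algebra_eq:
  assumes "convergent2 f" "convergent2 g"
  shows "local_algebra f g = \<complex>xy Quot ideal2 f g"
    and "scalars f g = (+>\<^bsub>\<complex>xy\<^esub>) (ideal2 f g) ` complex_constants"
  using assms by (simp_all add: local_algebra_def scalars_def genideal_eq_ideal2 image_image)

lemma has_dim_I:
  assumes "convergent2 f" "convergent2 g" "rel_dim (ideal2 f g) n {F. convergent2 F}"
  shows "has_dim f g n"
proof -
  have I: "ideal (ideal2 f g) \<complex>xy" using assms(1,2) by (rule ideal_ideal2)
  have "carrier (\<complex>xy Quot ideal2 f g) = (+>\<^bsub>\<complex>xy\<^esub>) (ideal2 f g) ` {F. convergent2 F}"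
    by (auto simp: FactRing_def A_RCOSETS_def')
  then show ?thesis
    using rel_dim_imp_dimension[OF I linear_subspace_ideal2[OF assms(1,2)] assms(3)]
    by (simp add: has_dim_def local_algebra_eq[OF assms(1,2)])
qed

lemma (in ring) dimension_zero_ring:
  assumes "dimension n K E" "carrier R = {\<zero>}"
  shows "n = 0 \<and> E = {\<zero>}"
  using assms(1)
proof (induction rule: dimension.induct)
  case (Suc_dim v E n)
  then show ?case using assms(2) by auto
qed simp

text \<open>
  A proper ideal leaves \<open>1 \<noteq> 0\<close> in the quotient, and a homomorphism to a nonzero ring maps a
  subfield onto a subfield.
\<close>
lemma subfield_scalars:
  assumes f: "convergent2 f" and g: "convergent2 g" and "1 \<notin> ideal2 f g"
  shows "ring (local_algebra f g)" "subfield (scalars f g) (local_algebra f g)"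
proof -
  interpret I: ideal "ideal2 f g" "\<complex>xy"
    using f g by (rule ideal_ideal2)
  interpret h: ring_hom_ring "\<complex>xy" "\<complex>xy Quot ideal2 f g" "(+>\<^bsub>\<complex>xy\<^esub>) (ideal2 f g)"
    by (rule I.rcos_ring_hom_ring)
  have "\<one>\<^bsub>\<complex>xy Quot ideal2 f g\<^esub> \<noteq> \<zero>\<^bsub>\<complex>xy Quot ideal2 f g\<^esub>"
    using I.a_rcos_self[of 1] assms(3) convergent2_one by (auto simp: FactRing_def)
  then have "subfield ((+>\<^bsub>\<complex>xy\<^esub>) (ideal2 f g) ` complex_constants) (\<complex>xy Quot ideal2 f g)"
    by (rule h.img_is_subfield(2)[OF subfield_complex_constants])
  then show "subfield (scalars f g) (local_algebra f g)"
    by (simp add: local_algebra_eq[OF f g])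
  show "ring (local_algebra f g)"
    using h.S.ring_axioms by (simp add: local_algebra_eq[OF f g])
qed

text \<open>
  For a proper ideal this is the invariance of dimension over a field. For the unit ideal the
  scalars do not form a field, but then no line can ever be added to \<open>{0}\<close>.
\<close>
lemma has_dim_unique:
  assumes f: "convergent2 f" and g: "convergent2 g" and n: "has_dim f g n" and m: "has_dim f g m"
  shows "n = m"
proof (cases "1 \<in> ideal2 f g")
  case False
  interpret ring "local_algebra f g" by (rule subfield_scalars[OF f g False])
  show ?thesis
    using dimension_is_inj[OF subfield_scalars(2)[OF f g False]] n m by (simp add: has_dim_def)
next
  case True
  interpret I: ideal "ideal2 f g" "\<complex>xy"
    using f g by (rule ideal_ideal2)
  interpret Q: ring "local_algebra f g"
    using I.quotient_is_ring by (simp add: local_algebra_eq[OF f g])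
  have whole: "ideal2 f g = carrier \<complex>xy"
    using I.one_imp_carrier True by simp
  have coset: "ideal2 f g +>\<^bsub>\<complex>xy\<^esub> F = ideal2 f g" if "convergent2 F" for F
    using I.a_rcos_const that whole by simp
  have carrier: "carrier (local_algebra f g) = {\<zero>\<^bsub>local_algebra f g\<^esub>}"
    using coset convergent2_zero
    by (auto simp: local_algebra_eq[OF f g] FactRing_def A_RCOSETS_def' intro!: exI[of _ 0])
  have zero: "k = 0" if "has_dim f g k" for k
    using Q.dimension_zero_ring[OF _ carrier] that unfolding has_dim_def by blast
  show ?thesis using zero[OF n] zero[OF m] by simp
qed

lemma intersection_number_eqI:
  assumes "convergent2 f" "convergent2 g" "rel_dim (ideal2 f g) n {F. convergent2 F}"
  shows "I\<^sub>0 f g = enat n"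
proof -
  have n: "has_dim f g n" using assms by (rule has_dim_I)
  then have "(THE n. has_dim f g n) = n" using has_dim_unique[OF assms(1,2)] by blast
  then show ?thesis using n by (auto simp: intersection_number_def)
qed

section \<open>Restriction to a coordinate axis\<close>

text \<open>
  The two coordinate axes play symmetric roles. The parameter \<open>z\<close> is the coordinate that cuts the
  axis out, \<open>w\<close> is the coordinate along the axis, and \<open>\<rho>\<close> restricts series to it. Thus \<open>\<rho>\<close> is a
  homomorphism to a ring of one-variable series whose kernel on \<open>O\<close> is generated by \<open>z\<close>. The
  assumption \<open>lift_shift\<close> says that dividing a restriction by a power of the variable and
  discarding the terms of lower order again gives the restriction of a convergent series. It is a
  substitute for computing with convergent series in one variable.
\<close>
locale coordinate_axis =
  fixes \<rho> :: "complex fps fps \<Rightarrow> complex fps" and z w :: "complex fps fps"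
  assumes convergent_z: "convergent2 z" and convergent_w: "convergent2 w" and z_nonzero: "z \<noteq> 0"
    and restrict_add: "\<rho> (F + G) = \<rho> F + \<rho> G"
    and restrict_mult: "\<rho> (F * G) = \<rho> F * \<rho> G"
    and restrict_const2: "\<rho> (const2 c) = fps_const c"
    and restrict_z: "\<rho> z = 0" and restrict_w: "\<rho> w = fps_X"
    and restrict_nth_0: "fps_nth (\<rho> F) 0 = value0 F"
    and divisible: "convergent2 F \<Longrightarrow> \<rho> F = 0 \<Longrightarrow> \<exists>G. convergent2 G \<and> F = z * G"
    and lift_shift: "convergent2 F \<Longrightarrow> \<exists>G. convergent2 G \<and> \<rho> G = fps_shift n (\<rho> F)"
begin

lemma restrict_simps [simp]:
  "\<rho> 0 = 0" "\<rho> 1 = 1" "\<rho> (- F) = - \<rho> F" "\<rho> (F - G) = \<rho> F - \<rho> G" "\<rho> (w ^ n) = fps_X ^ n"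
proof -
  show [simp]: "\<rho> 0 = 0" "\<rho> 1 = 1"
    using restrict_const2[of 0] restrict_const2[of 1] by (simp_all add: const2_simps)
  show [simp]: "\<rho> (- F) = - \<rho> F" for F
    using restrict_add[of F "- F"] by (simp add: eq_neg_iff_add_eq_0 add.commute)
  show "\<rho> (F - G) = \<rho> F - \<rho> G"
    using restrict_add[of F "- G"] by simp
  show "\<rho> (w ^ n) = fps_X ^ n"
    by (induction n) (simp_all add: restrict_mult restrict_w)
qed

text \<open>
  The ring of one-variable series is a domain, so the kernel of \<open>\<rho>\<close> is a prime ideal.
\<close>
lemma z_divides_cofactor:
  assumes "\<rho> f \<noteq> 0" "convergent2 p" "f * p = z * F"
  shows "\<exists>p'. convergent2 p' \<and> p = z * p'"
proof -
  have "\<rho> f * \<rho> p = 0" using assms(3) by (metis restrict_mult restrict_z mult_zero_left)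
  then show ?thesis using assms by (intro divisible) auto
qed

text \<open>
  The restriction of \<open>f\<close> is \<open>X ^ l\<close> times the restriction of a unit. If the restriction of \<open>F\<close>
  is divisible by \<open>X ^ l\<close>, then dividing by that unit gives a multiple of \<open>f\<close> with the same
  restriction as \<open>F\<close>, and the difference is divisible by \<open>z\<close>.
\<close>
lemma ideal2_z_iff:
  assumes f: "convergent2 f" "\<rho> f \<noteq> 0" and F: "convergent2 F"
  shows "F \<in> ideal2 f z \<longleftrightarrow> (\<forall>j<subdegree (\<rho> f). fps_nth (\<rho> F) j = 0)"
proof
  assume "F \<in> ideal2 f z"
  then obtain p q where "F = f * p + z * q" unfolding ideal2_def by blast
  then have "\<rho> F = \<rho> f * \<rho> p" by (simp add: restrict_add restrict_mult restrict_z)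
  then show "\<forall>j<subdegree (\<rho> f). fps_nth (\<rho> F) j = 0"
    by (auto simp: fps_mult_nth intro!: sum.neutral nth_less_subdegree_zero)
next
  define l where "l = subdegree (\<rho> f)"
  assume vanish: "\<forall>j<subdegree (\<rho> f). fps_nth (\<rho> F) j = 0"
  obtain u where u: "convergent2 u" "\<rho> u = fps_shift l (\<rho> f)"
    using lift_shift[OF f(1)] by blast
  obtain G where G: "convergent2 G" "\<rho> G = fps_shift l (\<rho> F)"
    using lift_shift[OF F] by blast
  have Rf: "\<rho> f = fps_X ^ l * \<rho> u"
    by (metis u(2) l_def order_refl fps_shift_times_fps_X_power mult.commute)
  have RF: "\<rho> F = fps_X ^ l * \<rho> G"
    using vanish by (intro fps_ext) (simp add: G(2) l_def fps_X_power_mult_nth)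
  have "value0 u = fps_nth (\<rho> f) l" using restrict_nth_0[of u] by (simp add: u(2))
  then have "value0 u \<noteq> 0" using f(2) by (simp add: l_def)
  then obtain v where v: "convergent2 v" "u * v = 1" by (rule convergent2_unit[OF u(1)])
  have "\<rho> (F - f * (v * G)) = fps_X ^ l * \<rho> G - fps_X ^ l * (\<rho> (u * v) * \<rho> G)"
    by (simp add: restrict_mult Rf RF mult_ac)
  also have "\<dots> = 0" by (simp add: v(2))
  finally obtain q where "convergent2 q" "F - f * (v * G) = z * q"
    using divisible[of "F - f * (v * G)"] F f(1) v(1) G(1)
    by (auto intro: convergent2_diff convergent2_mult)
  then show "F \<in> ideal2 f z"
    using ideal2I[of "v * G" q f z] v(1) G(1) by (simp add: convergent2_mult algebra_simps)
qed

text \<open>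
  The powers \<open>w ^ k\<close> with \<open>k < n\<close> form a basis of the series modulo those that vanish to order \<open>n\<close>
  along the axis.
\<close>
lemma rel_dim_truncation:
  "rel_dim {F. convergent2 F \<and> (\<forall>j<n. fps_nth (\<rho> F) j = 0)} n {F. convergent2 F}"
proof (induction n)
  case 0
  show ?case using rel_dim_refl by simp
next
  case (Suc n)
  let ?V = "\<lambda>n. {F. convergent2 F \<and> (\<forall>j<n. fps_nth (\<rho> F) j = 0)}"
  have wn: "convergent2 (w ^ n)" "w ^ n \<notin> ?V (Suc n)"
    using convergent_w by (auto simp: convergent2_power)
  have "F \<in> add_line (w ^ n) (?V (Suc n))" if F: "F \<in> ?V n" for F
  proof -
    let ?c = "fps_nth (\<rho> F) n"
    have "F - const2 ?c * w ^ n \<in> ?V (Suc n)"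
      using F wn(1)
      by (auto simp: convergent2_diff convergent2_mult convergent2_const2 restrict_mult
          restrict_const2 less_Suc_eq)
    moreover have "F = const2 ?c * w ^ n + (F - const2 ?c * w ^ n)" by simp
    ultimately show ?thesis unfolding add_line_def by blast
  qed
  moreover have "F \<in> ?V n" if F: "F \<in> add_line (w ^ n) (?V (Suc n))" for F
    using F wn(1)
    by (auto simp: add_line_def convergent2_add convergent2_mult convergent2_const2
        restrict_add restrict_mult restrict_const2)
  ultimately have "add_line (w ^ n) (?V (Suc n)) = ?V n" by blast
  then have "rel_dim (?V (Suc n)) (Suc 0) (?V n)"
    using rel_dim_step[OF wn rel_dim_refl] by metis
  then show ?case using rel_dim_trans[OF Suc] by fastforce
qed

text \<open>
  A chain from \<open>(f, h)\<close> to \<open>O\<close>, multiplied by \<open>z\<close>, becomes a chain of the same length from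
  \<open>(f, z h)\<close> to \<open>(f, z)\<close>. It is continued up to \<open>O\<close> by the chain of the orders of vanishing along
  the axis.
\<close>
lemma rel_dim_ideal2_z_mult:
  assumes f: "convergent2 f" "\<rho> f \<noteq> 0" and h: "convergent2 h"
    and n: "rel_dim (ideal2 f h) n {F. convergent2 F}"
  shows "rel_dim (ideal2 f (z * h)) (n + subdegree (\<rho> f)) {F. convergent2 F}"
proof -
  define S where "S = (\<lambda>B. {z * b + f * p |b p. b \<in> B \<and> convergent2 p})"
  have "rel_dim (S (ideal2 f h)) n (S {F. convergent2 F})"
    unfolding S_def
  proof (rule rel_dim_multiply[OF n linear_subspace_ideal2[OF f(1) h] convergent_z z_nonzero])
    show "f * p \<in> ideal2 f h" if "convergent2 p" for p
      using ideal2I[OF that convergent2_zero, of f h] by simp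
  qed (use z_divides_cofactor f in blast)
  moreover have "S (ideal2 f h) = ideal2 f (z * h)"
  proof (rule subset_antisym; rule subsetI)
    fix F assume "F \<in> S (ideal2 f h)"
    then obtain p q p' where pq: "convergent2 p" "convergent2 q" "convergent2 p'"
      "F = z * (f * p' + h * q) + f * p" unfolding S_def ideal2_def by blast
    then have "F = f * (z * p' + p) + z * h * q" by (simp add: algebra_simps)
    then show "F \<in> ideal2 f (z * h)"
      using ideal2I[of "z * p' + p" q] pq convergent_z by (simp add: convergent2_add convergent2_mult)
  next
    fix F assume "F \<in> ideal2 f (z * h)"
    then obtain p q where pq: "convergent2 p" "convergent2 q" "F = f * p + z * h * q"
      unfolding ideal2_def by blast
    have "h * q \<in> ideal2 f h" using ideal2I[OF convergent2_zero pq(2), of f h] by simp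
    moreover have "F = z * (h * q) + f * p" using pq(3) by (simp add: algebra_simps)
    ultimately show "F \<in> S (ideal2 f h)" using pq(1) unfolding S_def by blast
  qed
  moreover have "S {F. convergent2 F} = ideal2 f z"
    unfolding S_def ideal2_def by (simp add: add.commute) blast
  moreover have "ideal2 f z = {F. convergent2 F \<and> (\<forall>j<subdegree (\<rho> f). fps_nth (\<rho> F) j = 0)}"
    using ideal2_z_iff[OF f] ideal2_props(1)[OF f(1) convergent_z] by blast
  ultimately show ?thesis
    using rel_dim_trans[OF rel_dim_truncation[of "subdegree (\<rho> f)"]] by simp
qed

lemma rel_dim_ideal2_z_power_mult:
  assumes "m = 0 \<or> \<rho> f \<noteq> 0" and f: "convergent2 f" and h: "convergent2 h"
    and n: "rel_dim (ideal2 f h) n {F. convergent2 F}"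
  shows "rel_dim (ideal2 f (z ^ m * h)) (n + m * subdegree (\<rho> f)) {F. convergent2 F}"
  using assms(1)
proof (induction m)
  case 0
  show ?case using n by simp
next
  case (Suc m)
  then have "rel_dim (ideal2 f (z * (z ^ m * h))) (n + m * subdegree (\<rho> f) + subdegree (\<rho> f))
      {F. convergent2 F}"
    using f h convergent_z by (intro rel_dim_ideal2_z_mult convergent2_mult convergent2_power) auto
  then show ?case by (simp add: algebra_simps)
qed

text \<open>
  The ideal lies in the kernel of \<open>\<rho>\<close>, so it contains no nontrivial combination of the powers of
  \<open>w\<close>, whose restrictions are the powers of the variable. Their cosets form independent lists of
  every length.
\<close>
lemma intersection_number_infinite:
  assumes f: "convergent2 f" "\<rho> f = 0" and g: "convergent2 g" "\<rho> g = 0"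
  shows "I\<^sub>0 f g = \<infinity>"
proof -
  let ?I = "ideal2 f g" and ?Q = "local_algebra f g" and ?K = "scalars f g"
  have restrict_ideal: "\<rho> F = 0" if "F \<in> ?I" for F
    using that f g unfolding ideal2_def by (auto simp: restrict_add restrict_mult)
  have proper: "1 \<notin> ?I" using restrict_ideal[of 1] by auto
  interpret I: ideal "?I" "\<complex>xy"
    using f(1) g(1) by (rule ideal_ideal2)
  interpret h: ring_hom_ring "\<complex>xy" "?Q" "(+>\<^bsub>\<complex>xy\<^esub>) ?I"
    unfolding local_algebra_eq(1)[OF f(1) g(1)] by (rule I.rcos_ring_hom_ring)
  let ?h = "(+>\<^bsub>\<complex>xy\<^esub>) ?I"
  note K = local_algebra_eq(2)[OF f(1) g(1)]
  \<comment> \<open>Combinations of the first \<open>n\<close> powers of \<open>w\<close> restrict to polynomials of degree less than \<open>n\<close>.\<close>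
  define V where "V = (\<lambda>n. {F. convergent2 F \<and> (\<forall>j\<ge>n. fps_nth (\<rho> F) j = 0)})"
  define Us where "Us = (\<lambda>n. map (\<lambda>k. ?h (w ^ k)) (rev [0..<n]))"
  have w: "convergent2 (w ^ n)" for n using convergent_w by (rule convergent2_power)
  have span: "h.Span ?K (Us n) \<subseteq> ?h ` V n" for n
  proof (induction n)
    case 0
    have "\<zero>\<^bsub>?Q\<^esub> = ?h 0" using h.hom_zero by simp
    then show ?case by (auto simp: Us_def V_def convergent2_zero)
  next
    case (Suc n)
    show ?case
    proof
      fix v assume "v \<in> h.Span ?K (Us (Suc n))"
      then obtain k u where ku: "k \<in> ?K" "u \<in> h.Span ?K (Us n)"
        "v = k \<otimes>\<^bsub>?Q\<^esub> ?h (w ^ n) \<oplus>\<^bsub>?Q\<^esub> u"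
        by (auto simp: Us_def h.line_extension_mem_iff)
      obtain c where c: "k = ?h (const2 c)" using ku(1) K by auto
      obtain F where F: "F \<in> V n" "u = ?h F" using ku(2) Suc by blast
      have "v = ?h (const2 c * w ^ n + F)"
        using h.hom_add[of "const2 c * w ^ n" F] h.hom_mult[of "const2 c" "w ^ n"] ku(3) c F w
        by (simp add: V_def convergent2_mult convergent2_const2)
      moreover have "const2 c * w ^ n + F \<in> V (Suc n)"
        using F(1) w by (simp add: V_def convergent2_add convergent2_mult convergent2_const2
            restrict_add restrict_mult restrict_const2)
      ultimately show "v \<in> ?h ` V (Suc n)" by blast
    qed
  qed
  have independent: "h.independent ?K (Us n)" for n
  proof (induction n)
    case 0
    show ?case by (simp add: Us_def)
  next
    case (Suc n)
    have "?h (w ^ n) \<notin> h.Span ?K (Us n)"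
    proof
      assume "?h (w ^ n) \<in> h.Span ?K (Us n)"
      then obtain F where F: "F \<in> V n" "?h (w ^ n) = ?h F" using span by blast
      have "w ^ n \<in> ?h F" using I.a_rcos_self[of "w ^ n"] w F(2) by simp
      then obtain i where "i \<in> ?I" "w ^ n = i + F" by (auto simp: a_r_coset_def')
      then have "\<rho> (w ^ n) = \<rho> F" using restrict_ideal by (metis restrict_add add_0)
      then have "fps_nth (fps_X ^ n) n = fps_nth (\<rho> F) n" by simp
      then show False using F(1) by (simp add: V_def)
    qed
    then have "h.independent ?K (?h (w ^ n) # Us n)"
      using Suc w h.hom_closed[of "w ^ n"] by (intro h.li_Cons) auto
    then show ?case by (simp add: Us_def)
  qed
  have "\<not> has_dim f g n" for n
  proof
    assume "has_dim f g n"
    then have "h.dimension n ?K (carrier ?Q)" by (simp add: has_dim_def)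
    then have "length (Us (Suc n)) \<le> n"
      using h.independent_length_le_dimension[OF subfield_scalars(2)[OF f(1) g(1) proper] _ independent]
        h.independent_in_carrier[OF independent] by blast
    then show False by (simp add: Us_def)
  qed
  then show ?thesis by (simp add: intersection_number_def)
qed

end

interpretation y_axis: coordinate_axis restrict_y_axis var_x var_y
proof
  fix F assume F: "convergent2 F"
  show "\<exists>G. convergent2 G \<and> F = var_x * G" if "restrict_y_axis F = 0"
  proof -
    have "coeff2 F 0 j = 0" for j
      using that by (metis restrict_y_axis_def fps_nth_Abs_fps fps_zero_nth)
    then have "F = var_x * shift2 1 0 F"
      by (intro coeff2_eqI) (simp add: coeff2_var_x_mult)
    then show ?thesis using convergent2_shift2[OF F] by blast
  qed
  show "\<exists>G. convergent2 G \<and> restrict_y_axis G = fps_shift n (restrict_y_axis F)" for n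
    by (rule exI[of _ "shift2 0 n F"])
      (auto simp: convergent2_shift2[OF F] restrict_y_axis_def fps_eq_iff)
qed (simp_all add: convergent2_var_x convergent2_var_y restrict_y_axis_simps var_x_nonzero)

interpretation x_axis: coordinate_axis restrict_x_axis var_y var_x
proof
  fix F assume F: "convergent2 F"
  show "\<exists>G. convergent2 G \<and> F = var_y * G" if "restrict_x_axis F = 0"
  proof -
    have "coeff2 F i 0 = 0" for i
      using that by (metis restrict_x_axis_def fps_nth_Abs_fps fps_zero_nth)
    then have "F = var_y * shift2 0 1 F"
      by (intro coeff2_eqI) (simp add: coeff2_var_y_mult)
    then show ?thesis using convergent2_shift2[OF F] by blast
  qed
  show "\<exists>G. convergent2 G \<and> restrict_x_axis G = fps_shift n (restrict_x_axis F)" for n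
    by (rule exI[of _ "shift2 n 0 F"])
      (auto simp: convergent2_shift2[OF F] restrict_x_axis_def fps_eq_iff)
qed (simp_all add: convergent2_var_x convergent2_var_y restrict_x_axis_simps var_y_nonzero)

section \<open>Intersection with a monomial times a unit\<close>

theorem proposition7p1:
  fixes f g U :: "complex fps fps" and m\<^sub>1 m\<^sub>2 :: nat
  assumes "f \<in> carrier \<complex>xy" and "value0 f = 0"
    and "U \<in> carrier \<complex>xy" and "value0 U \<noteq> 0"
    and "g = (var_x [^]\<^bsub>\<complex>xy\<^esub> m\<^sub>1) \<otimes>\<^bsub>\<complex>xy\<^esub> (var_y [^]\<^bsub>\<complex>xy\<^esub> m\<^sub>2) \<otimes>\<^bsub>\<complex>xy\<^esub> U"
  shows "I\<^sub>0 f g = enat m\<^sub>1 * ell_y f + enat m\<^sub>2 * ell_x f"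
proof -
  have f: "convergent2 f" and U: "convergent2 U" using assms by simp_all
  have g: "g = var_x ^ m\<^sub>1 * (var_y ^ m\<^sub>2 * U)" using assms(5) by (simp add: mult.assoc)
  have convergent_g: "convergent2 g" unfolding g
    by (intro convergent2_mult convergent2_power convergent2_var_x convergent2_var_y U)
  consider (y) "m\<^sub>1 \<noteq> 0" "restrict_y_axis f = 0" | (x) "m\<^sub>2 \<noteq> 0" "restrict_x_axis f = 0"
    | (finite) "m\<^sub>1 = 0 \<or> restrict_y_axis f \<noteq> 0" "m\<^sub>2 = 0 \<or> restrict_x_axis f \<noteq> 0"
    by argo
  then show ?thesis
  proof cases
    case y
    then have "restrict_y_axis g = 0"
      by (cases m\<^sub>1) (simp_all add: g y_axis.restrict_mult y_axis.restrict_z)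
    then show ?thesis
      using y_axis.intersection_number_infinite[OF f y(2) convergent_g] y
      by (simp add: ell_y_def ord0_def imult_is_infinity zero_enat_def)
  next
    case x
    then have "restrict_x_axis g = 0"
      by (cases m\<^sub>2) (simp_all add: g x_axis.restrict_mult x_axis.restrict_z)
    then show ?thesis
      using x_axis.intersection_number_infinite[OF f x(2) convergent_g] x
      by (simp add: ell_x_def ord0_def imult_is_infinity zero_enat_def)
  next
    case finite
    obtain V where V: "convergent2 V" "U * V = 1" using convergent2_unit[OF U assms(4)] .
    have "F \<in> ideal2 f U" if "convergent2 F" for F
      using ideal2I[OF convergent2_zero convergent2_mult[OF V(1) that], of f U] V(2)
      by (simp flip: mult.assoc)
    then have "ideal2 f U = {F. convergent2 F}" using ideal2_props(1)[OF f U] by blast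
    then have "rel_dim (ideal2 f U) 0 {F. convergent2 F}" using rel_dim_refl by metis
    from x_axis.rel_dim_ideal2_z_power_mult[OF finite(2) f U this]
    have "rel_dim (ideal2 f g) (0 + m\<^sub>2 * subdegree (restrict_x_axis f)
        + m\<^sub>1 * subdegree (restrict_y_axis f)) {F. convergent2 F}"
      unfolding g
      by (intro y_axis.rel_dim_ideal2_z_power_mult[OF finite(1) f] convergent2_mult
          convergent2_power convergent2_var_y U)
    from intersection_number_eqI[OF f convergent_g this] show ?thesis
      using finite by (auto simp: ell_x_def ell_y_def ord0_def zero_enat_def[symmetric] add.commute)
  qed
qed

end
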